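(* Let $p$ be a prime and $n_1\in\{2,3\}$. Suppose $f(x)=a_{n_r}x^{n_r}+a_{n_{r-1}}x^{n_{r-1}}+\cdots+a_{n_1}x^{n_1}+p^u\epsilon\in \mathcal{S}_{n_1}$ is reducible over $\mathbb{Z}$ and $p^u>|a_{n_1}|+\cdots+|a_{n_r}|$. Then $f(x)$ has at most $n_1$ non-reciprocal irreducible factors.
   Context: Let $p$ be a prime number. For a positive integer $n_1$, $\mathcal{S}_{n_1}$ denotes the set of all polynomials $a_{n_r}x^{n_r}+a_{n_{r-1}}x^{n_{r-1}}+\cdots+a_{n_1}x^{n_1}+p^u\epsilon\in\mathbb{Z}[x]$ (with $r\ge 1$) such that $n_r>n_{r-1}>\cdots>n_1>0$ are integers, $u\ge 2$ is an integer, $\epsilon=\pm 1$, $p\nmid a_{n_1}a_{n_r}$, and every $a_{n_i}$ is a nonzero integer. For a polynomial $g$, put $\tilde g(x)=x^{\deg(g)}g(x^{-1})$; $g$ is called reciprocal if $g(x)=\pm\tilde g(x)$, and non-reciprocal otherwise. Irreducible factors are taken in $\mathbb{Z}[x]$. *)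

theory Defs
  imports "HOL-Computational_Algebra.Polynomial_Factorial"
begin

text \<open>
  \<open>S_poly p n1 r n a u \<epsilon> f\<close>: the polynomial \<open>f\<close> lies in the family \<open>S_set p n1\<close>, with
  the expansion given by \<open>r\<close>, \<open>n\<close>, \<open>a\<close>, \<open>u\<close>, \<open>\<epsilon>\<close>. The exponents are \<open>n 1 < \<dots> < n r\<close>, and
  \<open>a\<close> is indexed by exponents, so \<open>a (n i)\<close> is the coefficient of \<open>x ^ n i\<close>; values of
  \<open>n\<close> and \<open>a\<close> at other indices are irrelevant.
\<close>

definition S_poly ::
  "nat \<Rightarrow> nat \<Rightarrow> nat \<Rightarrow> (nat \<Rightarrow> nat) \<Rightarrow> (nat \<Rightarrow> int) \<Rightarrow> nat \<Rightarrow> int \<Rightarrow> int poly \<Rightarrow> bool" where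
  "S_poly p n1 r n a u \<epsilon> f \<longleftrightarrow>
     1 \<le> r \<and> n 1 = n1 \<and> 0 < n1 \<and> strict_mono_on {1..r} n \<and>
     2 \<le> u \<and> \<epsilon> \<in> {1, -1} \<and>
     (\<forall>i\<in>{1..r}. a (n i) \<noteq> 0) \<and>
     \<not> int p dvd a (n 1) * a (n r) \<and>
     f = (\<Sum>i=1..r. monom (a (n i)) (n i)) + [:int p ^ u * \<epsilon>:]"

definition S_set :: "nat \<Rightarrow> nat \<Rightarrow> int poly set" where
  "S_set p n1 = {f. \<exists>r n a u \<epsilon>. S_poly p n1 r n a u \<epsilon> f}"

definition reciprocal :: "int poly \<Rightarrow> bool" where
  "reciprocal g \<longleftrightarrow> g = reflect_poly g \<or> g = - reflect_poly g"

definition reducible :: "int poly \<Rightarrow> bool" where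
  "reducible f \<longleftrightarrow> f \<noteq> 0 \<and> \<not> is_unit f \<and> \<not> irreducible f"

text \<open>
  Irreducible factors in \<open>\<int>[x]\<close> up to sign, counted with multiplicity: irreducible and prime
  elements of \<open>\<int>[x]\<close> coincide, and \<open>prime_factorization\<close> picks the representative with
  positive leading coefficient. Being reciprocal does not depend on the sign.
\<close>

definition nonreciprocal_factors :: "int poly \<Rightarrow> int poly multiset" where
  "nonreciprocal_factors f = {#g \<in># prime_factorization f. \<not> reciprocal g#}"

end

theory Submission
  imports Defs "HOL-Computational_Algebra.Fundamental_Theorem_Algebra"
begin

text \<open>
  The bound holds for all irreducible factors of \<open>f\<close> together, reciprocal or not; two facts about
  the constant coefficients of these factors give it.

  Archimedean part: by \<open>p ^ u > \<bar>a (n 1)\<bar> + \<dots> + \<bar>a (n r)\<bar>\<close> the constant term of \<open>f\<close> dominates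
  the other terms on the closed unit disc, so \<open>f\<close> has no complex root there
  (\<open>poly_neq_0_if_constant_term_dominates\<close>). An integer polynomial with constant coefficient
  \<open>\<plusminus>1\<close> that is not itself \<open>\<plusminus>1\<close> does have such a root, because the absolute values of its roots
  have product at most \<open>1\<close> (\<open>exists_root_in_closed_unit_disc\<close>). So no irreducible factor
  has constant coefficient \<open>\<plusminus>1\<close>; since this coefficient divides \<open>\<plusminus>p ^ u\<close>, it is a multiple of \<open>p\<close>.

  Part at \<open>p\<close>: modulo \<open>p\<close> every irreducible factor is therefore divisible by \<open>x\<close>, and
  if there are \<open>k\<close> of them, then \<open>x ^ k\<close> divides \<open>f\<close> modulo \<open>p\<close>
  (\<open>dvd_low_coeffs_of_multiple_of_prod_mset\<close>). The coefficient of \<open>x ^ n1\<close> in \<open>f\<close> is prime to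
  \<open>p\<close>, hence \<open>k \<le> n1\<close>. In terms of Newton polygons: \<open>f\<close> has exactly \<open>n1\<close> \<open>p\<close>-adic roots of
  positive valuation, counted with multiplicity, and every irreducible factor contains at least one of them.
\<close>

text \<open>
  By Vieta, \<open>\<bar>p(0)\<bar>\<close> is \<open>\<bar>lead_coeff p\<bar>\<close> times the product of the absolute values of the roots, so it
  would exceed \<open>\<bar>lead_coeff p\<bar>\<close> if all of them lay outside the disc.
\<close>

lemma exists_root_in_closed_unit_disc:
  fixes p :: "complex poly"
  assumes deg: "degree p > 0" and le: "norm (coeff p 0) \<le> norm (lead_coeff p)"
  shows "\<exists>z. poly p z = 0 \<and> norm z \<le> 1"
proof (rule ccontr)
  assume "\<not> ?thesis"
  then have outside: "norm z > 1" if "poly p z = 0" for z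
    using that by force
  have "p \<noteq> 0"
    using deg by auto
  then obtain A where A: "size A = degree p" "p = smult (lead_coeff p) (\<Prod>x\<in>#A. [:-x, 1:])"
    using alg_closed_imp_factorization by blast
  have root: "poly p z = 0" if "z \<in># A" for z
    by (subst A(2)) (use that in \<open>auto simp: poly_prod_mset prod_mset_zero_iff\<close>)
  have prod_gt: "norm (\<Prod>x\<in>#B. - x) > 1" if "B \<noteq> {#}" "\<And>z. z \<in># B \<Longrightarrow> norm z > 1"
    for B :: "complex multiset"
    using that
  proof (induction B)
    case (add x B)
    show ?case
    proof (cases "B = {#}")
      case False
      then have "norm (\<Prod>x\<in>#B. - x) > 1" "norm x > 1"
        using add by auto
      then show ?thesis
        by (simp add: norm_mult less_1_mult)
    qed (use add in auto)
  qed auto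
  have "coeff p 0 = lead_coeff p * (\<Prod>x\<in>#A. - x)"
    by (subst A(2)) (simp add: poly_0_coeff_0 [symmetric] poly_prod_mset)
  then have "norm (coeff p 0) = norm (lead_coeff p) * norm (\<Prod>x\<in>#A. - x)"
    by (simp add: norm_mult)
  moreover have "A \<noteq> {#}"
    using A(1) deg by auto
  then have "norm (\<Prod>x\<in>#A. - x) > 1"
    by (rule prod_gt) (use root outside in auto)
  moreover have "norm (lead_coeff p) > 0"
    using \<open>p \<noteq> 0\<close> by simp
  ultimately show False
    using le by (simp add: mult_le_cancel_left1)
qed

lemma poly_neq_0_if_constant_term_dominates:
  fixes z d :: "'a :: real_normed_field"
  assumes "(\<Sum>i\<in>I. norm (c i)) < norm d" and "norm z \<le> 1"
  shows "poly ((\<Sum>i\<in>I. monom (c i) (n i)) + [:d:]) z \<noteq> 0"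
proof
  assume "poly ((\<Sum>i\<in>I. monom (c i) (n i)) + [:d:]) z = 0"
  then have "d = - (\<Sum>i\<in>I. c i * z ^ n i)"
    by (simp add: poly_sum poly_monom eq_neg_iff_add_eq_0 add.commute)
  then have "norm d = norm (\<Sum>i\<in>I. c i * z ^ n i)"
    by simp
  also have "\<dots> \<le> (\<Sum>i\<in>I. norm (c i) * norm z ^ n i)"
    by (rule sum_norm_le) (simp add: norm_mult norm_power)
  also have "\<dots> \<le> (\<Sum>i\<in>I. norm (c i))"
    using assms(2) by (intro sum_mono mult_left_le power_le_one) auto
  finally show False
    using assms(1) by simp
qed

text \<open>
  Modulo \<open>d\<close> each factor in \<open>A\<close> is divisible by \<open>x\<close>, hence the product by \<open>x ^ size A\<close>.
\<close>

lemma dvd_low_coeffs_of_multiple_of_prod_mset: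
  fixes d :: "'a :: comm_ring_1"
  assumes "\<And>g. g \<in># A \<Longrightarrow> d dvd coeff g 0" and "prod_mset A dvd f" and "j < size A"
  shows "d dvd coeff f j"
proof -
  obtain h where "f = prod_mset A * h"
    using assms(2) by blast
  moreover have "d dvd coeff (prod_mset A * h) j"
    using assms(1,3)
  proof (induction A arbitrary: j)
    case (add g A)
    have "d dvd coeff g i * coeff (prod_mset A * h) (j - i)" if "i \<le> j" for i
    proof (cases "i = 0")
      case True
      then show ?thesis
        using add.prems(1)[of g] by simp
    next
      case False
      then have "d dvd coeff (prod_mset A * h) (j - i)"
        using that add.prems by (intro add.IH) auto
      then show ?thesis
        by simp
    qed
    then show ?case
      by (auto simp: mult.assoc coeff_mult [of g] intro!: dvd_sum)
  qed simp
  ultimately show ?thesis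
    by simp
qed

text \<open>
  A unit constant coefficient is at most as large as the leading coefficient, so the root criterion
  \<open>exists_root_in_closed_unit_disc\<close> applies.
\<close>

lemma constant_term_not_unit_if_no_root_in_disc:
  fixes g :: "int poly"
  assumes "\<not> is_unit g"
    and no_root: "\<And>z :: complex. norm z \<le> 1 \<Longrightarrow> poly (map_poly of_int g) z \<noteq> 0"
  shows "\<not> is_unit (coeff g 0)"
proof
  assume unit: "is_unit (coeff g 0)"
  have "degree g > 0"
  proof (rule ccontr)
    assume "\<not> degree g > 0"
    then obtain c where "g = [:c:]"
      by (auto elim: degree_eq_zeroE)
    then show False
      using unit assms(1) by (simp add: is_unit_const_poly_iff)
  qed
  moreover have "\<bar>coeff g 0\<bar> \<le> \<bar>lead_coeff g\<bar>"
  proof -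
    have "lead_coeff g \<noteq> 0"
      using \<open>degree g > 0\<close> by auto
    then have "\<bar>lead_coeff g\<bar> \<ge> 1"
      by linarith
    then show ?thesis
      using unit by simp
  qed
  then have "norm (complex_of_int (coeff g 0)) \<le> norm (complex_of_int (lead_coeff g))"
    unfolding norm_of_int by linarith
  ultimately have "\<exists>z :: complex. poly (map_poly of_int g) z = 0 \<and> norm z \<le> 1"
    by (intro exists_root_in_closed_unit_disc) (simp_all add: degree_map_poly coeff_map_poly)
  then show False
    using no_root by blast
qed

text \<open>
  The count is made over all irreducible factors because the argument treats them alike: each has
  a non-unit divisor of \<open>\<plusminus>p ^ u\<close> as constant coefficient, so it vanishes at \<open>0\<close> modulo \<open>p\<close>,
  whereas \<open>f\<close> modulo \<open>p\<close> vanishes at \<open>0\<close> to order exactly \<open>n1\<close>.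
\<close>

lemma size_prime_factorization_le:
  fixes p n1 r u :: nat and n :: "nat \<Rightarrow> nat" and a :: "nat \<Rightarrow> int"
    and \<epsilon> :: int and f :: "int poly"
  assumes "prime p"
    and S: "S_poly p n1 r n a u \<epsilon> f"
    and dom: "int p ^ u > (\<Sum>i=1..r. \<bar>a (n i)\<bar>)"
  shows "size (prime_factorization f) \<le> n1"
proof (rule ccontr)
  have r: "1 \<le> r" and n1: "n 1 = n1" "0 < n1" and mono: "strict_mono_on {1..r} n"
    and eps: "\<epsilon> \<in> {1, -1}" and ndvd: "\<not> int p dvd a (n 1) * a (n r)"
    and f: "f = (\<Sum>i=1..r. monom (a (n i)) (n i)) + [:int p ^ u * \<epsilon>:]"
    using S unfolding S_poly_def by - (elim conjE, assumption)+
  have inj: "n i = n 1 \<longleftrightarrow> i = 1" if "i \<in> {1..r}" for i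
    using that r by (intro inj_on_eq_iff [OF strict_mono_on_imp_inj_on [OF mono]]) auto
  have pos: "n i > 0" if "i \<in> {1..r}" for i
    using strict_mono_onD [OF mono, of 1 i] that n1 by (cases "i = 1") auto
  have coeff_0: "coeff f 0 = int p ^ u * \<epsilon>"
  proof -
    have "(\<Sum>i=1..r. coeff (monom (a (n i)) (n i)) 0) = 0"
      using pos by (intro sum.neutral) (force simp: coeff_monom)
    then show ?thesis
      by (simp add: f coeff_sum del: coeff_monom)
  qed
  have coeff_n1: "coeff f n1 = a (n 1)"
  proof -
    have "(\<Sum>i=1..r. coeff (monom (a (n i)) (n i)) n1) = (\<Sum>i=1..r. if i = 1 then a (n i) else 0)"
      using inj n1 by (intro sum.cong) auto
    then show ?thesis
      using r n1 by (cases n1) (simp_all add: f coeff_sum del: coeff_monom)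
  qed
  have "f \<noteq> 0"
    using coeff_n1 ndvd by auto
  have f_no_root: "poly (map_poly of_int f) z \<noteq> 0" if "norm z \<le> 1" for z :: complex
  proof -
    have "map_poly of_int f
        = (\<Sum>i=1..r. monom (of_int (a (n i))) (n i)) + [:complex_of_int (int p ^ u * \<epsilon>):]"
      by (rule poly_eqI)
         (simp add: f coeff_map_poly coeff_sum coeff_pCons split: nat.split, auto intro!: sum.cong)
    moreover have "(\<Sum>i=1..r. norm (complex_of_int (a (n i))))
        < norm (complex_of_int (int p ^ u * \<epsilon>))"
    proof -
      have "(\<Sum>i=1..r. \<bar>a (n i)\<bar>) < \<bar>int p ^ u * \<epsilon>\<bar>"
        using dom eps by (auto simp: abs_mult)
      then have "real_of_int (\<Sum>i=1..r. \<bar>a (n i)\<bar>) < real_of_int \<bar>int p ^ u * \<epsilon>\<bar>"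
        by (simp only: of_int_less_iff)
      then show ?thesis
        unfolding norm_of_int by simp
    qed
    ultimately show ?thesis
      using poly_neq_0_if_constant_term_dominates [OF _ that] by metis
  qed
  have p_dvd: "int p dvd coeff g 0" if "g \<in># prime_factorization f" for g
  proof -
    have g: "prime g" "g dvd f"
      using that by (auto simp: in_prime_factors_iff)
    then obtain h where h: "f = g * h"
      by blast
    have "poly (map_poly of_int g) z \<noteq> 0" if "norm z \<le> 1" for z :: complex
    proof -
      have "map_poly complex_of_int f = map_poly of_int g * map_poly of_int h"
        by (rule poly_eqI) (simp add: h coeff_map_poly coeff_mult)
      then show ?thesis
        using f_no_root [OF that] by auto
    qed
    then have not_unit: "\<not> is_unit (coeff g 0)"
      using g(1) by (intro constant_term_not_unit_if_no_root_in_disc) (auto simp: prime_def)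
    have "coeff g 0 dvd int p ^ u * \<epsilon>"
      using coeff_0 by (metis h coeff_mult_0 dvd_triv_left)
    then have "coeff g 0 dvd int p ^ u"
      using eps by auto
    show ?thesis
    proof (rule ccontr)
      assume "\<not> int p dvd coeff g 0"
      then have "coprime (int p ^ u) (coeff g 0)"
        using \<open>prime p\<close> by (intro coprime_power_left_iff [THEN iffD2] disjI1 prime_imp_coprime) auto
      then show False
        using coprime_common_divisor [OF _ \<open>coeff g 0 dvd int p ^ u\<close> dvd_refl] not_unit by simp
    qed
  qed
  have "prod_mset (prime_factorization f) dvd f"
    using prod_mset_prime_factorization_weak [OF \<open>f \<noteq> 0\<close>] by (metis associatedD1)
  moreover assume "\<not> ?thesis"
  then have "n1 < size (prime_factorization f)"
    by simp
  ultimately have "int p dvd coeff f n1"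
    using dvd_low_coeffs_of_multiple_of_prod_mset p_dvd by blast
  then show False
    using coeff_n1 ndvd by simp
qed

theorem corollary5:
  fixes p n1 r u :: nat and n :: "nat \<Rightarrow> nat" and a :: "nat \<Rightarrow> int"
    and \<epsilon> :: int and f :: "int poly"
  assumes "prime p"
    and "n1 \<in> {2, 3}"
    and "S_poly p n1 r n a u \<epsilon> f"
    and "reducible f"
    and "int p ^ u > (\<Sum>i=1..r. \<bar>a (n i)\<bar>)"
  shows "size (nonreciprocal_factors f) \<le> n1"
proof -
  have "size (nonreciprocal_factors f) \<le> size (prime_factorization f)"
    unfolding nonreciprocal_factors_def by (rule size_filter_mset_lesseq)
  also have "\<dots> \<le> n1"
    using assms(1,3,5) by (rule size_prime_factorization_le)
  finally show ?thesis .
qed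

end
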